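(* An affine permutation $w\in\widetilde S_n$ is $1$-stack-sortable if and only if it is $231$-avoiding. The number of $1$-stack-sortable elements of $\widetilde S_n$ is $\binom{2n-1}{n}$.
   Context: An affine permutation of size $n$ is a bijection $w:\mathbb Z\to\mathbb Z$ with $w(i+n)=w(i)+n$ for all $i\in\mathbb Z$ and $\sum_{i=1}^n w(i)=\binom{n+1}{2}$. They form the affine symmetric group $\widetilde S_n$ under composition, a Coxeter group of type $\widetilde A_{n-1}$ with simple generators $\widetilde s_1,\ldots,\widetilde s_n$, where $\widetilde s_i$ swaps $i+mn$ and $i+mn+1$ for all $m\in\mathbb Z$ and fixes all other integers. The left weak order is $x\leq_L y\iff\ell(yx^{-1})=\ell(y)-\ell(x)$, $\ell$ being Coxeter length; $e$ is the identity. Affine sylvester congruence. For $w\in\widetilde S_n$ define a partial order $\preceq_w$ on $\mathbb Z$ (positions): for $i<j$, the positions $i,j$ are incomparable if and only if there is $k$ with $i<k<j$ and $w(k)>\max\{w(i),w(j)\}$; otherwise the position with the smaller value of $w$ is below the other. (This is the descendant order of the decreasing affine binary plane tree with in-order reading $w$.) The affine sylvester congruence is $v\equiv_{\widetilde{\mathrm{syl}}}w\iff{\preceq_v}={\preceq_w}$; it is a semilattice congruence on $(\widetilde S_n,\leq_L)$ in which $\{e\}$ is a class, and each class has a unique $\leq_L$-minimal element. Let $\pi_\downarrow(w)$ be the minimal element of the class of $w$. The affine stack-sorting map is $\widetilde{\mathtt s}:\widetilde S_n\to\widetilde S_n$, $\widetilde{\mathtt s}(w)=w\,(\pi_\downarrow(w))^{-1}$.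 An affine permutation $w\in\widetilde S_n$ is $1$-stack-sortable if $\widetilde{\mathtt s}(w)=e$. It is $231$-avoiding if there are no $i<j<k$ in $\mathbb Z$ with $w(k)<w(i)<w(j)$. The enumeration of $231$-avoiding affine permutations in $\widetilde S_n$ as $\binom{2n-1}{n}$ is due to Crites. *)

theory Defs
  imports Complex_Main
begin

definition affine_sym :: "nat \<Rightarrow> (int \<Rightarrow> int) set" where
  "affine_sym n = {w. bij w \<and> (\<forall>i. w (i + int n) = w i + int n) \<and>
     (\<Sum>i = 1..int n. w i) = int ((n + 1) choose 2)}"

text \<open>The residues of \<open>i\<close> and \<open>i + 1\<close> are distinct only for \<open>n \<ge> 2\<close>. For \<open>n = 1\<close> the function
  \<open>affine_gen 1 1\<close> is the translation by 1, which lies outside \<open>affine_sym 1 = {id}\<close>;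
  it plays no role there because \<open>id\<close> has length 0.\<close>

definition affine_gen :: "nat \<Rightarrow> int \<Rightarrow> int \<Rightarrow> int" where
  "affine_gen n i x =
     (if x mod int n = i mod int n then x + 1
      else if x mod int n = (i + 1) mod int n then x - 1
      else x)"

definition cox_length :: "nat \<Rightarrow> (int \<Rightarrow> int) \<Rightarrow> nat" where
  "cox_length n w =
     (LEAST k. \<exists>is. length is = k \<and> set is \<subseteq> {1..int n} \<and>
        w = foldr (\<lambda>i f. affine_gen n i \<circ> f) is id)"

definition left_weak_le :: "nat \<Rightarrow> (int \<Rightarrow> int) \<Rightarrow> (int \<Rightarrow> int) \<Rightarrow> bool" where
  "left_weak_le n x y \<longleftrightarrow>
     int (cox_length n (y \<circ> inv x)) = int (cox_length n y) - int (cox_length n x)"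

text \<open>\<open>desc_le w i j\<close> is the reflexive relation \<open>i \<preceq>\<^sub>w j\<close> on positions: \<open>i\<close> and \<open>j\<close> are comparable
  unless a position strictly between them carries a value larger than both \<open>w i\<close> and \<open>w j\<close>,
  and comparable positions are ordered by their values.\<close>

definition desc_le :: "(int \<Rightarrow> int) \<Rightarrow> int \<Rightarrow> int \<Rightarrow> bool" where
  "desc_le w i j \<longleftrightarrow>
     \<not> (\<exists>k. min i j < k \<and> k < max i j \<and> w k > max (w i) (w j)) \<and> w i \<le> w j"

definition syl_cong :: "(int \<Rightarrow> int) \<Rightarrow> (int \<Rightarrow> int) \<Rightarrow> bool" where
  "syl_cong v w \<longleftrightarrow> desc_le v = desc_le w"

definition pi_down :: "nat \<Rightarrow> (int \<Rightarrow> int) \<Rightarrow> (int \<Rightarrow> int)" where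
  "pi_down n w =
     (THE x. x \<in> affine_sym n \<and> syl_cong x w \<and>
        (\<forall>y \<in> affine_sym n. syl_cong y w \<and> left_weak_le n y x \<longrightarrow> y = x))"

definition affine_stack_sort :: "nat \<Rightarrow> (int \<Rightarrow> int) \<Rightarrow> (int \<Rightarrow> int)" where
  "affine_stack_sort n w = w \<circ> inv (pi_down n w)"

definition one_stack_sortable :: "nat \<Rightarrow> (int \<Rightarrow> int) \<Rightarrow> bool" where
  "one_stack_sortable n w \<longleftrightarrow> affine_stack_sort n w = id"

definition avoids_231 :: "(int \<Rightarrow> int) \<Rightarrow> bool" where
  "avoids_231 w \<longleftrightarrow> \<not> (\<exists>i j k. i < j \<and> j < k \<and> w k < w i \<and> w i < w j)"

end

(* One-stack-sortability means w = pi_down w. Length equals the number of inversions modulo shift,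
   so a weak-order minimal element of a class avoids 231: in a 231 pattern with values b+1, c, b,
   swapping b and b+1 keeps the class and lowers the length. Conversely, every inversion of a
   231-avoider is a comparable pair, so a class contains at most one 231-avoider.

   For the enumeration, a 231-avoider w is encoded by its height function
   h(i) = #{p < i. w(p) > w(i)} up to a constant. It is n-periodic and rises by at most 1 per step.
   The first m > i with w(m) > w(i) is also the first m > i with h(m) <= h(i); call it R(i).
   These m determine the relative order of the values of w, and conversely R(i) - h(i), up to a
   constant, is a 231-avoider for every such h. The numbers h(i) + 1 - h(i+1) form an arbitrary
   sequence of n naturals with sum n, and there are (2n-1 choose n) of those. *)

theory Submission
  imports Defs
begin

section \<open>Shift-equivariant maps\<close>

lemma shift_int_multiple:
  fixes f :: "int \<Rightarrow> int"
  assumes "\<And>i. f (i + m) = f i + c"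
  shows "f (i + k * m) = f i + k * c"
proof (induction k rule: int_induct[where k = 0])
  case base
  then show ?case by simp
next
  case (step1 k)
  then show ?case using assms[of "i + k * m"] by (simp add: algebra_simps)
next
  case (step2 k)
  then show ?case using assms[of "i + (k - 1) * m"] by (simp add: algebra_simps)
qed

text \<open>Representatives are taken in \<open>{1..int n}\<close>, the window over which
  \<open>affine_sym\<close> sums.\<close>

definition residue :: "nat \<Rightarrow> int \<Rightarrow> int" where
  "residue n x = (x - 1) mod int n + 1"

lemma residue_range: "n \<ge> 1 \<Longrightarrow> residue n x \<in> {1..int n}"
  using pos_mod_sign[of "int n" "x - 1"] pos_mod_bound[of "int n" "x - 1"]
  unfolding residue_def atLeastAtMost_iff by linarith

lemma residue_decomp: "x = residue n x + ((x - 1) div int n) * int n"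
  using div_mult_mod_eq[of "x - 1" "int n"] unfolding residue_def by linarith

lemma residue_eqD:
  assumes "residue n x = residue n y"
  obtains k where "x = y + k * int n"
proof
  show "x = y + ((x - 1) div int n - (y - 1) div int n) * int n"
    using residue_decomp[of x n] residue_decomp[of y n] assms by (simp add: left_diff_distrib)
qed

text \<open>If two residues agree, then equivariance and injectivity make the arguments differ by a
  multiple of \<open>n\<close>, which is zero inside the window. A self-injection of a finite set is
  onto.\<close>

lemma shift_bij_residue:
  fixes u :: "int \<Rightarrow> int"
  assumes n: "n \<ge> 1" and inj: "inj u" and shift: "\<And>i. u (i + int n) = u i + int n"
  shows "bij_betw (\<lambda>i. residue n (u i)) {1..int n} {1..int n}"
proof -
  have "inj_on (\<lambda>i. residue n (u i)) {1..int n}"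
  proof (rule inj_onI)
    fix i j assume ij: "i \<in> {1..int n}" "j \<in> {1..int n}" "residue n (u i) = residue n (u j)"
    obtain k where "u i = u j + k * int n" using ij(3) by (rule residue_eqD)
    then have "u i = u (j + k * int n)" using shift_int_multiple[of u, OF shift] by simp
    then have e: "i = j + k * int n" using inj by (simp add: inj_eq)
    have "\<bar>k * int n\<bar> < 1 * int n" using ij e by auto
    then have "\<bar>k\<bar> < 1" by (simp only: abs_mult abs_of_nat mult_less_cancel_right)
    then show "i = j" using e by simp
  qed
  moreover have "(\<lambda>i. residue n (u i)) ` {1..int n} \<subseteq> {1..int n}"
    using residue_range[OF n] by blast
  ultimately show ?thesis
    by (simp add: bij_betw_def endo_inj_surj)
qed

lemma shift_inj_imp_bij:
  fixes u :: "int \<Rightarrow> int"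
  assumes n: "n \<ge> 1" and inj: "inj u" and shift: "\<And>i. u (i + int n) = u i + int n"
  shows "bij u"
proof -
  have "\<exists>x. u x = y" for y
  proof -
    have "residue n y \<in> (\<lambda>i. residue n (u i)) ` {1..int n}"
      using shift_bij_residue[OF assms] residue_range[OF n] by (simp add: bij_betw_def)
    then obtain i where "residue n y = residue n (u i)" by blast
    then obtain k where "y = u i + k * int n" by (rule residue_eqD)
    then have "u (i + k * int n) = y" using shift_int_multiple[of u, OF shift] by simp
    then show ?thesis by blast
  qed
  then show ?thesis using inj unfolding bij_def surj_def by metis
qed

text \<open>\<open>u\<close> permutes the residue classes, and \<open>g\<close> depends only on the
  class.\<close>

lemma sum_period_reindex:
  fixes u g :: "int \<Rightarrow> int"
  assumes n: "n \<ge> 1" and inj: "inj u" and shift: "\<And>i. u (i + int n) = u i + int n"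
    and per: "\<And>i. g (i + int n) = g i"
  shows "(\<Sum>i = 1..int n. g (u i)) = (\<Sum>i = 1..int n. g i)"
proof -
  have "g (residue n x) = g x" for x
    using shift_int_multiple[of g "int n" 0 "residue n x" "(x - 1) div int n"] per
      residue_decomp[of x n] by simp
  then have "(\<Sum>i = 1..int n. g (u i)) = (\<Sum>i = 1..int n. g (residue n (u i)))" by simp
  also have "\<dots> = (\<Sum>i = 1..int n. g i)"
    by (rule sum.reindex_bij_betw[OF shift_bij_residue[OF n inj shift]])
  finally show ?thesis .
qed

lemma sum_interval_int: "(\<Sum>i = 1..int n. i) = int ((n + 1) choose 2)"
proof (induction n)
  case (Suc n)
  have "{1..int (Suc n)} = insert (int (Suc n)) {1..int n}" by auto
  then show ?case using Suc by (simp add: numeral_2_eq_2)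
qed simp

text \<open>Modulo \<open>n\<close> the values over a window are a permutation of the window. This
  later makes the division in \<open>height_to_perm\<close> exact.\<close>

lemma sum_period_mod:
  fixes u :: "int \<Rightarrow> int"
  assumes n: "n \<ge> 1" and inj: "inj u" and shift: "\<And>i. u (i + int n) = u i + int n"
  obtains c where "(\<Sum>i = 1..int n. u i) = int ((n + 1) choose 2) + c * int n"
proof -
  define q where "q x = (x - 1) div int n" for x :: int
  have "(\<Sum>i = 1..int n. u i) = (\<Sum>i = 1..int n. residue n (u i) + q (u i) * int n)"
    using residue_decomp[of _ n] by (simp add: q_def)
  also have "\<dots> = (\<Sum>i = 1..int n. residue n (u i)) + (\<Sum>i = 1..int n. q (u i)) * int n"
    by (simp add: sum.distrib sum_distrib_right)
  also have "(\<Sum>i = 1..int n. residue n (u i)) = (\<Sum>i = 1..int n. i)"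
    by (rule sum.reindex_bij_betw[OF shift_bij_residue[OF assms]])
  finally show ?thesis by (intro that) (simp only: sum_interval_int)
qed

section \<open>The affine symmetric group\<close>

lemma affine_symD:
  assumes "w \<in> affine_sym n"
  shows "bij w" "inj w" "surj w" "w (i + int n) = w i + int n"
    "(\<Sum>i = 1..int n. w i) = int ((n + 1) choose 2)"
  using assms by (auto simp: affine_sym_def bij_def)

text \<open>For equivariant \<open>w\<close> the displacement \<open>w i - i\<close> is
  \<open>n\<close>-periodic, so \<open>sum_period_reindex\<close> applies to it, as composition and
  inverse require.\<close>

lemma affine_sym_iff_displacement:
  "w \<in> affine_sym n \<longleftrightarrow>
     bij w \<and> (\<forall>i. w (i + int n) = w i + int n) \<and> (\<Sum>i = 1..int n. w i - i) = 0"
  by (auto simp: affine_sym_def sum_subtractf sum_interval_int)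

lemma affine_sym_id: "id \<in> affine_sym n"
  by (simp add: affine_sym_iff_displacement)

lemma affine_sym_comp:
  assumes n: "n \<ge> 1" and v: "v \<in> affine_sym n" and w: "w \<in> affine_sym n"
  shows "v \<circ> w \<in> affine_sym n"
proof -
  have "(\<Sum>i = 1..int n. (v \<circ> w) i - i) = (\<Sum>i = 1..int n. (v (w i) - w i) + (w i - i))"
    by simp
  also have "\<dots> = (\<Sum>i = 1..int n. v (w i) - w i) + (\<Sum>i = 1..int n. w i - i)"
    by (simp only: sum.distrib)
  also have "(\<Sum>i = 1..int n. v (w i) - w i) = (\<Sum>i = 1..int n. v i - i)"
    by (rule sum_period_reindex[OF n, where g = "\<lambda>x. v x - x"])
      (auto simp: affine_symD[OF v] affine_symD[OF w])
  finally show ?thesis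
    using v w by (simp add: affine_sym_iff_displacement bij_comp)
qed

lemma affine_sym_inv:
  assumes n: "n \<ge> 1" and w: "w \<in> affine_sym n"
  shows "inv w \<in> affine_sym n"
proof -
  have shift: "inv w (i + int n) = inv w i + int n" for i
    by (rule inv_f_eq) (simp_all add: affine_symD[OF w] surj_f_inv_f)
  have bij: "bij (inv w)" using w by (simp add: affine_sym_def bij_imp_bij_inv)
  have "(\<Sum>i = 1..int n. inv w i - i) = (\<Sum>i = 1..int n. inv w i - w (inv w i))"
    by (simp add: affine_symD[OF w] surj_f_inv_f)
  also have "\<dots> = (\<Sum>i = 1..int n. i - w i)"
    by (rule sum_period_reindex[OF n, where g = "\<lambda>x. x - w x"])
      (auto simp: affine_symD[OF w] shift bij_is_inj[OF bij])
  also have "\<dots> = - (\<Sum>i = 1..int n. w i - i)" by (simp add: sum_negf[symmetric])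
  finally show ?thesis using w shift bij by (simp add: affine_sym_iff_displacement)
qed

text \<open>Equal relative orders make \<open>v \<circ> inv w\<close> an order automorphism of the
  integers, hence a translation, and the prescribed window sum forces it to be trivial.\<close>

lemma affine_sym_eqI:
  assumes n: "n \<ge> 1" and v: "v \<in> affine_sym n" and w: "w \<in> affine_sym n"
    and ord: "\<And>i j. i < j \<Longrightarrow> v i < v j \<longleftrightarrow> w i < w j"
  shows "v = w"
proof -
  have ord': "v i < v j \<longleftrightarrow> w i < w j" for i j
    using ord[of i j] ord[of j i] inj_eq[OF affine_symD(2)[OF v], of i j]
      inj_eq[OF affine_symD(2)[OF w], of i j]
    by (cases i j rule: linorder_cases) (auto simp: not_less_iff_gr_or_eq)
  define u where "u x = v (inv w x)" for x
  have uw: "u (w i) = v i" for i by (simp add: u_def affine_symD[OF w])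
  have wi: "w (inv w x) = x" for x by (simp add: affine_symD[OF w] surj_f_inv_f)
  have mono: "u x < u y \<longleftrightarrow> x < y" for x y using ord'[of "inv w x" "inv w y"] by (simp add: u_def wi)
  have step: "u (x + 1) = u x + 1" for x
  proof -
    \<comment> \<open>\<open>u\<close> sends \<open>w j\<close> to \<open>u x + 1\<close>. No
      integer lies strictly between \<open>u x\<close> and \<open>u x + 1\<close>, so by
      monotonicity none lies between \<open>x\<close> and \<open>w j\<close>.\<close>
    obtain j where j: "u x + 1 = v j" using affine_symD(3)[OF v] by (metis surj_def)
    then have "u (w j) = u x + 1" using uw by simp
    moreover from this have "x < w j" using mono[of x "w j"] by linarith
    ultimately show ?thesis using mono[of x "x + 1"] mono[of "w j" "x + 1"] by linarith
  qed
  have "u x = u 0 + x" for x using shift_int_multiple[of u 1 1 0 x] step by simp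
  then have vw: "v i = u 0 + w i" for i using uw by metis
  then have "(\<Sum>i = 1..int n. v i) = int n * u 0 + (\<Sum>i = 1..int n. w i)"
    by (simp add: sum.distrib)
  then have "u 0 = 0" using affine_symD(5)[OF v] affine_symD(5)[OF w] n by simp
  then show ?thesis using vw by auto
qed

lemma affine_sym_bounded_displacement:
  assumes n: "n \<ge> 1" and w: "w \<in> affine_sym n"
  obtains B where "\<And>i. \<bar>w i - i\<bar> \<le> B"
proof
  fix i
  let ?d = "\<lambda>x. w x - x"
  have "?d (residue n i + ((i - 1) div int n) * int n) = ?d (residue n i) + ((i - 1) div int n) * 0"
    by (rule shift_int_multiple) (simp add: affine_symD[OF w])
  then have "?d i = ?d (residue n i)" using residue_decomp[of i n] by simp
  moreover have "\<bar>?d (residue n i)\<bar> \<le> (\<Sum>j = 1..int n. \<bar>?d j\<bar>)"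
    using residue_range[OF n] by (intro member_le_sum) auto
  ultimately show "\<bar>w i - i\<bar> \<le> (\<Sum>j = 1..int n. \<bar>w j - j\<bar>)" by simp
qed

section \<open>Coxeter length as inversion number\<close>

text \<open>Placing the smaller position in the window selects one inversion from each orbit under
  simultaneous shifts by \<open>n\<close>.\<close>

definition inversions :: "nat \<Rightarrow> (int \<Rightarrow> int) \<Rightarrow> (int \<times> int) set" where
  "inversions n w = {(p, q). p \<in> {1..int n} \<and> p < q \<and> w q < w p}"

lemma finite_inversions:
  assumes "n \<ge> 1" "w \<in> affine_sym n"
  shows "finite (inversions n w)"
proof -
  obtain B where B: "\<And>i. \<bar>w i - i\<bar> \<le> B" using affine_sym_bounded_displacement[OF assms] by blast
  have "inversions n w \<subseteq> {1..int n} \<times> {1..int n + 2 * B}"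
  proof (clarsimp simp: inversions_def)
    fix p q assume "1 \<le> p" "p \<le> int n" "p < q" "w q < w p"
    then show "q \<le> int n + 2 * B" using B[of p] B[of q] by linarith
  qed
  then show ?thesis by (rule finite_subset) simp
qed

lemma inversion_residue:
  assumes n: "n \<ge> 1" and w: "w \<in> affine_sym n" and "p < q" "w q < w p"
  shows "(residue n p, q + (residue n p - p)) \<in> inversions n w"
proof -
  define k where "k = - ((p - 1) div int n)"
  have k: "residue n p = p + k * int n" using residue_decomp[of p n] by (simp add: k_def)
  have "w (x + k * int n) = w x + k * int n" for x
    by (rule shift_int_multiple) (simp add: affine_symD[OF w])
  then show ?thesis using assms residue_range[OF n, of p] by (simp add: inversions_def k)
qed

lemma inversions_empty_imp_id:
  assumes n: "n \<ge> 1" and w: "w \<in> affine_sym n" and e: "inversions n w = {}"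
  shows "w = id"
proof (rule affine_sym_eqI[OF n w affine_sym_id])
  fix i j :: int assume "i < j"
  then show "w i < w j \<longleftrightarrow> id i < id j"
    using inversion_residue[OF n w \<open>i < j\<close>] e inj_eq[OF affine_symD(2)[OF w], of i j] by force
qed

section \<open>Generators acting on values\<close>

lemma affine_gen_mod: "affine_gen n (a mod int n) = affine_gen n a"
  by (rule ext) (simp add: affine_gen_def mod_simps)

lemma affine_gen_residue: "affine_gen n (residue n a) = affine_gen n a"
proof -
  have "residue n a mod int n = a mod int n"
    using residue_decomp[of a n] by (metis mod_mult_self1)
  then show ?thesis using affine_gen_mod by metis
qed

lemma mod_succ_neq:
  assumes "n \<ge> 2" shows "(a + 1) mod int n \<noteq> a mod int n"
proof
  assume "(a + 1) mod int n = a mod int n"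
  then have "int n dvd (a + 1) - a" by (simp only: mod_eq_dvd_iff)
  then show False using assms by simp
qed

lemma mod_succ_cong: "(x + 1) mod int n = (a + 1) mod int n \<longleftrightarrow> x mod int n = a mod int n"
  by (simp add: mod_eq_dvd_iff)

lemma affine_gen_invol:
  assumes "n \<ge> 2" shows "affine_gen n a (affine_gen n a x) = x"
proof -
  have "(x - 1) mod int n = a mod int n" if "x mod int n = (a + 1) mod int n"
    using that mod_succ_cong[of "x - 1" n a] by simp
  then show ?thesis
    using mod_succ_neq[OF assms, of a] mod_succ_cong[of x n a] by (auto simp: affine_gen_def)
qed

lemma affine_gen_comp_invol:
  assumes "n \<ge> 2" shows "affine_gen n a \<circ> (affine_gen n a \<circ> w) = w"
  using affine_gen_invol[OF assms] by auto

lemma affine_gen_in_affine_sym: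
  assumes n: "n \<ge> 2" shows "affine_gen n a \<in> affine_sym n"
proof -
  let ?f = "\<lambda>x. of_bool (x mod int n = (a + 1) mod int n) :: int"
  have "(\<Sum>i = 1..int n. affine_gen n a i - i) = (\<Sum>i = 1..int n. ?f (i + 1) - ?f i)"
    using mod_succ_neq[OF n, of a] by (intro sum.cong) (auto simp: affine_gen_def mod_succ_cong)
  also have "\<dots> = (\<Sum>i = 1..int n. ?f (i + 1)) - (\<Sum>i = 1..int n. ?f i)"
    by (rule sum_subtractf)
  also have "(\<Sum>i = 1..int n. ?f (i + 1)) = (\<Sum>i = 1..int n. ?f i)"
    using n by (intro sum_period_reindex) auto
  finally have "(\<Sum>i = 1..int n. affine_gen n a i - i) = 0" by simp
  moreover have "bij (affine_gen n a)"
    using affine_gen_invol[OF n] by (metis involuntory_imp_bij)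
  ultimately show ?thesis
    unfolding affine_sym_iff_displacement by (auto simp: affine_gen_def)
qed

lemma affine_gen_comp_in_affine_sym:
  "n \<ge> 2 \<Longrightarrow> w \<in> affine_sym n \<Longrightarrow> affine_gen n a \<circ> w \<in> affine_sym n"
  by (simp add: affine_sym_comp affine_gen_in_affine_sym)

text \<open>Each integer moves by at most one and the map is injective, so integers at distance two
  or more keep their order.\<close>

lemma affine_gen_less_iff:
  assumes n: "n \<ge> 2" and "x < y"
  shows "affine_gen n a x < affine_gen n a y \<longleftrightarrow> \<not> (x mod int n = a mod int n \<and> y = x + 1)"
proof (cases "y = x + 1")
  case True
  then show ?thesis
    using mod_succ_neq[OF n, of a] mod_succ_neq[OF n, of x] mod_succ_cong[of x n a]
    by (auto simp: affine_gen_def)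
next
  case False
  then have "y \<ge> x + 2" using assms by simp
  moreover have "affine_gen n a x \<noteq> affine_gen n a y"
    using assms affine_gen_invol[OF n, of a] by (metis less_irrefl)
  ultimately show ?thesis by (auto simp: affine_gen_def split: if_splits)
qed

text \<open>Left multiplication only reverses pairs of positions whose values are consecutive and
  start in the class of \<open>a\<close>. These pairs form one orbit under shifts, they are ascents
  because \<open>p < q\<close>, and one of them starts in the window.\<close>

lemma inversions_affine_gen_ascent:
  assumes n: "n \<ge> 2" and w: "w \<in> affine_sym n" and pq: "p < q"
    and wp: "w p mod int n = a mod int n" and wq: "w q = w p + 1"
  shows "card (inversions n (affine_gen n a \<circ> w)) = Suc (card (inversions n w))"
proof -
  \<comment> \<open>\<open>k\<close> moves the pair to the member of its orbit that
    \<open>inversions\<close> counts.\<close>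
  define k where "k = residue n p - p"
  define m where "m = - ((p - 1) div int n)"
  have n1: "n \<ge> 1" using n by simp
  have m: "k = m * int n" using residue_decomp[of p n] by (simp add: m_def k_def)
  have shift: "w (x + l * int n) = w x + l * int n" for x l
    by (rule shift_int_multiple) (simp add: affine_symD[OF w])
  let ?v = "affine_gen n a \<circ> w"
  have range: "p + k \<in> {1..int n}" using residue_range[OF n1, of p] by (simp add: k_def)
  have uniq: "x = p + k \<and> y = q + k"
    if x: "x \<in> {1..int n}" "w x mod int n = a mod int n" and y: "w y = w x + 1" for x y
  proof -
    have "int n dvd w x - w p" using x wp by (metis mod_eq_dvd_iff)
    then obtain l where "w x - w p = int n * l" by (rule dvdE)
    then have "w x = w (p + l * int n)" "w y = w (q + l * int n)"
      using shift y wq by (auto simp: algebra_simps)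
    then have e: "x = p + l * int n" "y = q + l * int n"
      using affine_symD(2)[OF w] by (auto dest: injD)
    have "\<bar>(l - m) * int n\<bar> < 1 * int n" using x range e m by (auto simp: algebra_simps)
    then have "\<bar>l - m\<bar> < 1" by (simp only: abs_mult abs_of_nat mult_less_cancel_right)
    then show ?thesis using e m by simp
  qed
  have wk: "w (p + k) = w p + k" "w (q + k) = w p + 1 + k" using shift m wq by auto
  have wkm: "w (p + k) mod int n = a mod int n" using wk m wp by simp
  have "inversions n ?v = insert (p + k, q + k) (inversions n w)"
  proof (rule set_eqI, clarify)
    fix x y
    show "(x, y) \<in> inversions n ?v \<longleftrightarrow> (x, y) \<in> insert (p + k, q + k) (inversions n w)"
    proof (cases "x \<in> {1..int n} \<and> x < y")
      case False
      then show ?thesis using range pq by (auto simp: inversions_def)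
    next
      case True
      then have "w x \<noteq> w y" using affine_symD(2)[OF w] by (auto dest: injD)
      then consider "w x < w y" | "w y < w x" by linarith
      then show ?thesis
      proof cases
        case 1
        have ne: "?v x \<noteq> ?v y"
          using \<open>w x \<noteq> w y\<close> affine_gen_invol[OF n, of a] by (metis comp_apply)
        have "(x, y) \<in> inversions n ?v \<longleftrightarrow> \<not> affine_gen n a (w x) < affine_gen n a (w y)"
          using True ne by (auto simp: inversions_def)
        also have "\<dots> \<longleftrightarrow> w x mod int n = a mod int n \<and> w y = w x + 1"
          using affine_gen_less_iff[OF n 1] by simp
        also have "\<dots> \<longleftrightarrow> (x, y) = (p + k, q + k)"
          using uniq[of x y] True wk wkm by auto
        finally show ?thesis using 1 by (auto simp: inversions_def)
      next
        case 2
        \<comment> \<open>No inversion is lost: one with such values would be a shift of the pair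
          \<open>q\<close>, \<open>p\<close> with \<open>q\<close> on the left, against
          \<open>p < q\<close>.\<close>
        have "\<not> (w y mod int n = a mod int n \<and> w x = w y + 1)"
        proof
          assume as: "w y mod int n = a mod int n \<and> w x = w y + 1"
          define l where "l = - ((y - 1) div int n)"
          have l: "residue n y = y + l * int n" using residue_decomp[of y n] by (simp add: l_def)
          have "y + l * int n = p + k \<and> x + l * int n = q + k"
            using uniq[of "y + l * int n" "x + l * int n"] residue_range[OF n1, of y] as shift l
            by simp
          then show False using True pq by linarith
        qed
        then show ?thesis using True 2 affine_gen_less_iff[OF n 2, of a] wk pq
          by (auto simp: inversions_def)
      qed
    qed
  qed
  moreover have "(p + k, q + k) \<notin> inversions n w" using wk by (simp add: inversions_def)
  ultimately show ?thesis using finite_inversions[OF n1 w] by simp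
qed

text \<open>The generator is an involution, so this is the ascent case for
  \<open>affine_gen n a \<circ> w\<close>.\<close>

lemma inversions_affine_gen_descent:
  assumes n: "n \<ge> 2" and w: "w \<in> affine_sym n" and pq: "p < q"
    and wq: "w q mod int n = a mod int n" and wp: "w p = w q + 1"
  shows "card (inversions n w) = Suc (card (inversions n (affine_gen n a \<circ> w)))"
proof -
  have "(w q + 1) mod int n = (a + 1) mod int n" using wq mod_succ_cong by blast
  then have "(affine_gen n a \<circ> w) p = w q" "(affine_gen n a \<circ> w) q = w q + 1"
    using wq wp mod_succ_neq[OF n, of a] by (auto simp: affine_gen_def)
  then show ?thesis
    using inversions_affine_gen_ascent[OF n affine_gen_comp_in_affine_sym[OF n w] pq, of a a]
    by (simp add: wq affine_gen_comp_invol[OF n])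
qed

lemma inversions_affine_gen_le:
  assumes n: "n \<ge> 2" and w: "w \<in> affine_sym n"
  shows "card (inversions n (affine_gen n a \<circ> w)) \<le> Suc (card (inversions n w))"
proof -
  obtain p where p: "w p = a" using affine_symD(3)[OF w] by (metis surj_def)
  obtain q where q: "w q = a + 1" using affine_symD(3)[OF w] by (metis surj_def)
  consider "p < q" | "q < p" using p q by (cases p q rule: linorder_cases) auto
  then show ?thesis
    using inversions_affine_gen_ascent[OF n w, of p q a] p q
      inversions_affine_gen_descent[OF n w, of q p a] by cases auto
qed

section \<open>Words in the generators and reduced expressions\<close>

abbreviation gen_word :: "nat \<Rightarrow> int list \<Rightarrow> int \<Rightarrow> int" where
  "gen_word n is \<equiv> foldr (\<lambda>i f. affine_gen n i \<circ> f) is id"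

text \<open>Each letter adds at most one inversion, so the inversion number bounds the Coxeter
  length from below.\<close>

lemma gen_word_inversions:
  assumes n: "n \<ge> 2"
  shows "gen_word n is \<in> affine_sym n \<and> card (inversions n (gen_word n is)) \<le> length is"
proof (induction "is")
  case Nil
  have "inversions n id = {}" by (auto simp: inversions_def)
  then show ?case using affine_sym_id by (simp add: id_def)
next
  case (Cons a as)
  have "gen_word n (a # as) = affine_gen n a \<circ> gen_word n as" by simp
  moreover have "affine_gen n a \<circ> gen_word n as \<in> affine_sym n"
    using affine_gen_comp_in_affine_sym[OF n] Cons by blast
  moreover have "card (inversions n (affine_gen n a \<circ> gen_word n as)) \<le> Suc (length as)"
    using inversions_affine_gen_le[OF n, of "gen_word n as" a] Cons by (meson le_trans Suc_le_mono)
  ultimately show ?case by (simp only: length_Cons)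
qed

text \<open>Without such a pair \<open>inv w\<close> increases at every step, so it preserves the
  order and equals \<open>id\<close>.\<close>

lemma exists_descent:
  assumes n: "n \<ge> 1" and w: "w \<in> affine_sym n" and "w \<noteq> id"
  obtains p q where "p < q" "w p = w q + 1"
proof -
  have "\<exists>x. inv w (x + 1) < inv w x"
  proof (rule ccontr)
    assume none: "\<nexists>x. inv w (x + 1) < inv w x"
    have ne: "inv w (x + 1) \<noteq> inv w x" for x
      using affine_symD(3)[OF w] by (metis surj_f_inv_f add_cancel_left_right zero_neq_one)
    have step: "inv w x < inv w (x + 1)" for x
      using none ne[of x] by (meson linorder_neqE)
    have mono: "inv w x < inv w y" if "x < y" for x y
      using that by (induction y rule: int_gr_induct) (use step less_trans in blast)+
    have "inv w = id"
      by (rule affine_sym_eqI[OF n affine_sym_inv[OF n w] affine_sym_id]) (simp add: mono)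
    then have "w x = x" for x using affine_symD(3)[OF w] by (metis surj_f_inv_f id_apply)
    then show False using \<open>w \<noteq> id\<close> by auto
  qed
  then obtain x where "inv w (x + 1) < inv w x" by blast
  then show ?thesis
    by (rule that) (simp add: affine_symD(3)[OF w] surj_f_inv_f)
qed

text \<open>Removing a descent lowers the inversion number by exactly one, so the bound from
  \<open>gen_word_inversions\<close> is attained.\<close>

lemma exists_reduced_word:
  assumes n: "n \<ge> 2"
  shows "w \<in> affine_sym n \<Longrightarrow>
    \<exists>is. length is = card (inversions n w) \<and> set is \<subseteq> {1..int n} \<and> w = gen_word n is"
proof (induction "card (inversions n w)" arbitrary: w rule: less_induct)
  case less
  have n1: "n \<ge> 1" using n by simp
  show ?case
  proof (cases "w = id")
    case True
    have "inversions n id = {}" by (auto simp: inversions_def)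
    then show ?thesis using True by (intro exI[of _ "[]"]) simp
  next
    case False
    then obtain p q where pq: "p < q" "w p = w q + 1" using exists_descent[OF n1 less.prems] by blast
    define a where "a = w q"
    let ?v = "affine_gen n a \<circ> w"
    have card: "card (inversions n w) = Suc (card (inversions n ?v))"
      using inversions_affine_gen_descent[OF n less.prems pq(1), of a] pq by (simp add: a_def)
    obtain "is" where w': "length is = card (inversions n ?v)" "set is \<subseteq> {1..int n}"
        "?v = gen_word n is"
      using less.hyps[of ?v] card affine_gen_comp_in_affine_sym[OF n less.prems] by auto
    \<comment> \<open>The index is replaced by its residue because letters must lie in
      \<open>{1..int n}\<close>.\<close>
    have "w = affine_gen n (residue n a) \<circ> ?v"
      by (simp only: affine_gen_residue affine_gen_comp_invol[OF n])
    then show ?thesis using w' card residue_range[OF n1, of a]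
      by (intro exI[of _ "residue n a # is"]) simp
  qed
qed

lemma cox_length_eq_inversions:
  assumes n: "n \<ge> 2" and w: "w \<in> affine_sym n"
  shows "cox_length n w = card (inversions n w)"
  unfolding cox_length_def
proof (rule Least_equality)
  show "\<exists>is. length is = card (inversions n w) \<and> set is \<subseteq> {1..int n} \<and> w = gen_word n is"
    using exists_reduced_word[OF assms] .
qed (use gen_word_inversions[OF n] in blast)

section \<open>Minimal elements of affine sylvester classes\<close>

text \<open>A 231 pattern with the least gap \<open>w i - w k\<close> has gap 1.\<close>

lemma minimal_231_adjacent:
  assumes w: "w \<in> affine_sym n" and "\<not> avoids_231 w"
  obtains i j k where "i < j" "j < k" "w i = w k + 1" "w i < w j"
proof -
  define P where "P d \<longleftrightarrow> (\<exists>i j k. i < j \<and> j < k \<and> w k < w i \<and> w i < w j \<and> nat (w i - w k) = d)" for d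
  have "\<exists>d. P d" using assms(2) by (auto simp: avoids_231_def P_def)
  then have "P (LEAST d. P d)" by (rule LeastI_ex)
  then obtain i j k where ijk: "i < j" "j < k" "w k < w i" "w i < w j"
    and d: "nat (w i - w k) = (LEAST d. P d)" unfolding P_def by blast
  have least: "w i - w k \<le> w a - w c" if "a < b" "b < c" "w c < w a" "w a < w b" for a b c
  proof -
    have "P (nat (w a - w c))" using that unfolding P_def by blast
    then have "nat (w i - w k) \<le> nat (w a - w c)" unfolding d by (rule Least_le)
    then show ?thesis using that by simp
  qed
  \<comment> \<open>If the gap exceeds 1, this position yields a smaller one: left of
    \<open>j\<close> it replaces \<open>i\<close>, right of \<open>j\<close> it replaces
    \<open>k\<close>.\<close>
  obtain p where p: "w p = w k + 1" using affine_symD(3)[OF w] by (metis surj_def)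
  have "w i = w k + 1"
  proof (rule ccontr)
    assume "w i \<noteq> w k + 1"
    then have lt: "w p < w i" using p ijk by simp
    then have "p \<noteq> j" using ijk by auto
    then consider "p < j" | "j < p" by linarith
    then show False
    proof cases
      case 1
      then show False using least[of p j k] ijk lt p by simp
    next
      case 2
      then show False using least[of i j p] ijk lt p by simp
    qed
  qed
  then show ?thesis using that ijk by blast
qed

text \<open>By \<open>hidden\<close>, the two maps order a pair differently only when a position in
  between is larger under both. The order of a \<open>w\<close>-comparable pair thus survives, and
  any obstruction under \<open>v\<close> produces one under \<open>w\<close>.\<close>

lemma desc_le_imp:
  assumes hidden: "\<And>x y. (w x < w y) \<noteq> (v x < v y) \<Longrightarrow>
      \<exists>m. min x y < m \<and> m < max x y \<and> w m > max (w x) (w y) \<and> v m > max (v x) (v y)"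
    and le: "desc_le w x y"
  shows "desc_le v x y"
proof -
  have wxy: "w x \<le> w y"
    and none: "\<And>m. min x y < m \<Longrightarrow> m < max x y \<Longrightarrow> \<not> w m > max (w x) (w y)"
    using le unfolding desc_le_def by blast+
  have "v x \<le> v y"
    using hidden[of y x] wxy none by (metis linorder_not_le max.commute min.commute)
  moreover have False if m: "min x y < m" "m < max x y" "v m > max (v x) (v y)" for m
  proof -
    let ?I = "{min x y<..<max x y}"
    have I: "finite (v ` ?I)" "v ` ?I \<noteq> {}" using m by auto
    \<comment> \<open>Choose the largest \<open>v\<close>-value in between. A disagreement about
      \<open>p\<close> and an endpoint would need a still larger \<open>v\<close>-value inside the
      interval, so \<open>p\<close> obstructs under \<open>w\<close> too.\<close>
    obtain p where p: "p \<in> ?I" "v p = Max (v ` ?I)" using Max_in[OF I] by auto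
    have top: "v q \<le> v p" if "q \<in> ?I" for q using that I p by auto
    have "v m \<le> v p" using top m by auto
    then have vp: "v x < v p" "v y < v p" using m by auto
    have "w z < w p" if z: "z = x \<or> z = y" for z
    proof (rule ccontr)
      assume "\<not> w z < w p"
      then obtain q where q: "min z p < q" "q < max z p" "v q > max (v z) (v p)"
        using hidden[of z p] vp z by blast
      then have "q \<in> ?I" using z p(1) by auto
      then show False using top[of q] q by simp
    qed
    then show False using none[of p] p(1) by auto
  qed
  ultimately show ?thesis unfolding desc_le_def by blast
qed

text \<open>The assumption is symmetric in \<open>v\<close> and \<open>w\<close>, so
  \<open>desc_le_imp\<close> applies in both directions.\<close>

lemma desc_le_eqI:
  assumes "\<And>x y. (w x < w y) \<noteq> (v x < v y) \<Longrightarrow>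
      \<exists>m. min x y < m \<and> m < max x y \<and> w m > max (w x) (w y) \<and> v m > max (v x) (v y)"
  shows "desc_le v = desc_le w"
proof (intro ext iffI)
  fix x y
  show "desc_le w x y" if "desc_le v x y"
  proof (rule desc_le_imp[OF _ that])
    fix x y assume "(v x < v y) \<noteq> (w x < w y)"
    from assms[OF this[symmetric]] show
      "\<exists>m. min x y < m \<and> m < max x y \<and> v m > max (v x) (v y) \<and> w m > max (w x) (w y)"
      by blast
  qed
  show "desc_le v x y" if "desc_le w x y"
    by (rule desc_le_imp[OF _ that]) (fact assms)
qed

text \<open>Swapping the values \<open>a\<close> and \<open>a + 1\<close> only affects pairs of positions that a larger value in
  between makes incomparable, so the descendant order does not change.\<close>

lemma syl_cong_affine_gen:
  assumes n: "n \<ge> 2" and w: "w \<in> affine_sym n"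
    and ijk: "i < j" "j < k" "w i = w k + 1" "w i < w j"
  shows "syl_cong (affine_gen n (w k) \<circ> w) w"
proof -
  let ?s = "affine_gen n (w k)"
  let ?v = "?s \<circ> w"
  have shift: "w (x + l * int n) = w x + l * int n" for x l
    by (rule shift_int_multiple) (simp add: affine_symD[OF w])
  have inj_s: "?s x = ?s y \<longleftrightarrow> x = y" for x y
    using affine_gen_invol[OF n, of "w k"] by metis
  have swap: "\<exists>m. min x y < m \<and> m < max x y \<and> w m > max (w x) (w y) \<and> ?v m > max (?v x) (?v y)"
    if "w x < w y" "\<not> ?v x < ?v y" for x y
  proof -
    have xy: "w x mod int n = w k mod int n" "w y = w x + 1"
      using affine_gen_less_iff[OF n that(1)] that(2) by auto
    then have "int n dvd w x - w k" by (simp add: mod_eq_dvd_iff)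
    then obtain l where "w x - w k = int n * l" by (rule dvdE)
    then have "w x = w (k + l * int n)" "w y = w (i + l * int n)"
      using shift xy ijk by (auto simp: algebra_simps)
    then have e: "x = k + l * int n" "y = i + l * int n"
      using affine_symD(2)[OF w] by (auto dest: injD)
    \<comment> \<open>The reversed pair is a shift of \<open>k\<close>, \<open>i\<close>; the same
      shift of \<open>j\<close> lies between and is larger.\<close>
    let ?m = "j + l * int n"
    have m: "w ?m > w x" "w ?m > w y" "w ?m > w x + 1" using ijk shift e xy(2) by auto
    have "?s (w x) < ?s (w ?m)" "?s (w y) < ?s (w ?m)"
      using affine_gen_less_iff[OF n m(1), of "w k"] affine_gen_less_iff[OF n m(2), of "w k"]
        m mod_succ_neq[OF n, of "w x"] xy by auto
    then show ?thesis using e m ijk by (intro exI[of _ ?m]) auto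
  qed
  have swap': "\<exists>m. min x y < m \<and> m < max x y \<and> w m > max (w x) (w y) \<and> ?v m > max (?v x) (?v y)"
    if "(w x < w y) \<noteq> (?v x < ?v y)" for x y
  proof (cases "w x < w y")
    case True
    then show ?thesis using swap that by blast
  next
    case False
    then have "w y < w x" "\<not> ?v y < ?v x" using that by (auto simp: not_less le_less)
    then show ?thesis using swap[of y x] by (simp add: min.commute max.commute)
  qed
  have "desc_le ?v = desc_le w"
    by (rule desc_le_eqI) (fact swap')
  then show ?thesis unfolding syl_cong_def .
qed

text \<open>A larger value between the two positions of an inversion would complete a 231 pattern.
  So \<open>desc_le\<close> records all inversions of a 231-avoider, and these fix its relative
  order.\<close>

lemma syl_cong_avoids_unique:
  assumes n: "n \<ge> 1" and v: "v \<in> affine_sym n" and w: "w \<in> affine_sym n"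
    and "syl_cong v w" "avoids_231 v" "avoids_231 w"
  shows "v = w"
proof (rule affine_sym_eqI[OF n v w])
  have inv_mono: "b q < b p"
    if "inj a" and "avoids_231 a" and "desc_le a = desc_le b" and "p < q" "a q < a p"
      and "inj b" for a b :: "int \<Rightarrow> int" and p q
  proof -
    have "desc_le a q p"
      using that unfolding desc_le_def avoids_231_def by (auto simp: min_def max_def)
    then have "desc_le b q p" using that by simp
    then have "b q \<le> b p" unfolding desc_le_def by simp
    moreover have "b q \<noteq> b p" using that by (auto dest: injD)
    ultimately show ?thesis by simp
  qed
  fix i j :: int assume "i < j"
  have "v i \<noteq> v j" "w i \<noteq> w j"
    using \<open>i < j\<close> affine_symD(2)[OF v] affine_symD(2)[OF w] by (auto dest: injD)
  moreover have "w j < w i" if "v j < v i"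
    by (rule inv_mono[of v w]) (use that assms \<open>i < j\<close> affine_symD(2) in \<open>auto simp: syl_cong_def\<close>)
  moreover have "v j < v i" if "w j < w i"
    by (rule inv_mono[of w v]) (use that assms \<open>i < j\<close> affine_symD(2) in \<open>auto simp: syl_cong_def\<close>)
  ultimately show "v i < v j \<longleftrightarrow> w i < w j" by linarith
qed

section \<open>Existence and uniqueness of the minimal class member\<close>

lemma cox_length_0_imp_id:
  assumes n: "n \<ge> 2" and w: "w \<in> affine_sym n" and "cox_length n w = 0"
  shows "w = id"
  using assms inversions_empty_imp_id[of n w] finite_inversions[of n w]
  by (simp add: cox_length_eq_inversions)

lemma cox_length_affine_gen:
  assumes n: "n \<ge> 2"
  shows "cox_length n (affine_gen n a) = 1"
proof -
  have e: "inversions n id = {}" by (auto simp: inversions_def)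
  have "card (inversions n (affine_gen n a \<circ> id)) = Suc (card (inversions n id))"
    using inversions_affine_gen_ascent[OF n affine_sym_id, of a "a + 1" a] by simp
  then show ?thesis
    using cox_length_eq_inversions[OF n affine_gen_in_affine_sym[OF n]] e by (simp add: id_def comp_def)
qed

text \<open>The property under \<open>THE\<close> in \<open>pi_down\<close>. It only asks for
  minimality, so uniqueness has to come from 231-avoidance.\<close>

definition syl_minimal :: "nat \<Rightarrow> (int \<Rightarrow> int) \<Rightarrow> (int \<Rightarrow> int) \<Rightarrow> bool" where
  "syl_minimal n w x \<longleftrightarrow> x \<in> affine_sym n \<and> syl_cong x w \<and>
     (\<forall>y \<in> affine_sym n. syl_cong y w \<and> left_weak_le n y x \<longrightarrow> y = x)"

lemma comp_inv_comp:
  assumes "bij x" "bij s"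
  shows "x \<circ> inv (s \<circ> x) = inv s"
proof -
  have "x \<circ> inv x = id" using assms(1) by (simp add: bij_is_surj surj_iff[symmetric])
  then show ?thesis using assms by (simp add: o_inv_distrib comp_assoc[symmetric])
qed

lemma syl_minimal_avoids_231:
  assumes n: "n \<ge> 2" and min: "syl_minimal n w x"
  shows "avoids_231 x"
proof (rule ccontr)
  have x: "x \<in> affine_sym n" and xw: "syl_cong x w" using min by (auto simp: syl_minimal_def)
  assume "\<not> avoids_231 x"
  then obtain i j k where ijk: "i < j" "j < k" "x i = x k + 1" "x i < x j"
    using minimal_231_adjacent[OF x] by blast
  define s where "s = affine_gen n (x k)"
  have s: "s \<in> affine_sym n" and y: "s \<circ> x \<in> affine_sym n"
    using affine_gen_in_affine_sym[OF n] affine_gen_comp_in_affine_sym[OF n x] by (auto simp: s_def)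
  have "inv s = s" using affine_gen_invol[OF n] by (intro inv_equality) (auto simp: s_def)
  \<comment> \<open>The quotient is one generator, of length 1, matching the drop of the inversion
    number by one; hence \<open>s \<circ> x\<close> is below \<open>x\<close> in the left weak
    order.\<close>
  then have "x \<circ> inv (s \<circ> x) = s"
    using comp_inv_comp[OF affine_symD(1)[OF x] affine_symD(1)[OF s]] by simp
  moreover have "card (inversions n x) = Suc (card (inversions n (s \<circ> x)))"
    using inversions_affine_gen_descent[OF n x, of i k "x k"] ijk by (simp add: s_def)
  ultimately have "left_weak_le n (s \<circ> x) x"
    unfolding left_weak_le_def cox_length_eq_inversions[OF n x] cox_length_eq_inversions[OF n y]
    using cox_length_affine_gen[OF n] by (simp add: s_def)
  moreover have "syl_cong (s \<circ> x) w"
    using syl_cong_affine_gen[OF n x ijk] xw by (simp add: s_def syl_cong_def)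
  ultimately have "s \<circ> x = x" using min y by (auto simp: syl_minimal_def)
  then have "s (x k) = x k" by (metis comp_apply)
  then show False by (simp add: s_def affine_gen_def)
qed

text \<open>Take a class member of least length. A class member weakly below it gives a quotient of
  length 0, hence equals it.\<close>

lemma syl_minimal_exists:
  assumes n: "n \<ge> 2" and w: "w \<in> affine_sym n"
  shows "\<exists>x. syl_minimal n w x"
proof -
  define x where "x = arg_min (cox_length n) (\<lambda>x. x \<in> affine_sym n \<and> syl_cong x w)"
  have "w \<in> affine_sym n \<and> syl_cong w w" using w by (simp add: syl_cong_def)
  from arg_min_nat_lemma[of "\<lambda>x. x \<in> affine_sym n \<and> syl_cong x w", OF this, of "cox_length n"]
  have x: "x \<in> affine_sym n" "syl_cong x w"
    and least: "\<And>y. y \<in> affine_sym n \<Longrightarrow> syl_cong y w \<Longrightarrow> cox_length n x \<le> cox_length n y"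
    by (auto simp: x_def)
  have "y = x" if y: "y \<in> affine_sym n" "syl_cong y w" "left_weak_le n y x" for y
  proof -
    have "cox_length n (x \<circ> inv y) = 0"
      using y(3) least[OF y(1,2)] unfolding left_weak_le_def by simp
    moreover have "x \<circ> inv y \<in> affine_sym n"
      using n x(1) y(1) by (simp add: affine_sym_comp affine_sym_inv)
    ultimately have "x \<circ> inv y = id" using cox_length_0_imp_id[OF n] by blast
    then show ?thesis using affine_symD(2)[OF y(1)]
      by (metis comp_assoc comp_id id_comp inv_o_cancel)
  qed
  then show ?thesis using x unfolding syl_minimal_def by blast
qed

text \<open>Minimal members avoid 231, and a class has at most one 231-avoider, so
  \<open>THE\<close> is well defined.\<close>

lemma pi_down_spec:
  assumes n: "n \<ge> 2" and w: "w \<in> affine_sym n"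
  shows "pi_down n w \<in> affine_sym n" "syl_cong (pi_down n w) w" "avoids_231 (pi_down n w)"
proof -
  have eq: "pi_down n w = (THE x. syl_minimal n w x)"
    by (simp add: pi_down_def syl_minimal_def)
  obtain x where x: "syl_minimal n w x" using syl_minimal_exists[OF assms] by blast
  have "y = x" if y: "syl_minimal n w y" for y
  proof (rule syl_cong_avoids_unique)
    show "n \<ge> 1" using n by simp
    show "syl_cong y x" using x y by (simp add: syl_minimal_def syl_cong_def)
  qed (use x y syl_minimal_avoids_231[OF n] in \<open>auto simp: syl_minimal_def\<close>)
  then have "syl_minimal n w (pi_down n w)" unfolding eq by (rule theI[of "syl_minimal n w", OF x])
  then show "pi_down n w \<in> affine_sym n" "syl_cong (pi_down n w) w" "avoids_231 (pi_down n w)"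
    using syl_minimal_avoids_231[OF n] by (auto simp: syl_minimal_def)
qed

text \<open>Settles \<open>n = 1\<close> separately: there \<open>a\<close> and \<open>a + 1\<close>
  have the same residue, and the facts on generators do not apply.\<close>

lemma affine_sym_1: "affine_sym 1 = {id}"
proof -
  have "w = id" if w: "w \<in> affine_sym 1" for w
  proof (rule affine_sym_eqI[OF _ w affine_sym_id])
    fix i j :: int
    have "w i = w 0 + i" for i using shift_int_multiple[of w 1 1 0 i] affine_symD(4)[OF w] by simp
    then show "w i < w j \<longleftrightarrow> id i < id j" by (metis add_less_cancel_left id_apply)
  qed simp
  then show ?thesis using affine_sym_id by blast
qed

lemma one_stack_sortable_iff_avoids_231:
  assumes n: "n \<ge> 1" and w: "w \<in> affine_sym n"
  shows "one_stack_sortable n w \<longleftrightarrow> avoids_231 w"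
proof (cases "n = 1")
  case True
  then have [simp]: "w = id" using w affine_sym_1 by simp
  have "pi_down 1 id = id"
    unfolding pi_down_def by (rule the_equality) (auto simp: affine_sym_1[simplified] syl_cong_def)
  then show ?thesis
    using True by (auto simp: one_stack_sortable_def affine_stack_sort_def avoids_231_def)
next
  case False
  then have n2: "n \<ge> 2" using n by simp
  note pi = pi_down_spec[OF n2 w]
  have "one_stack_sortable n w \<longleftrightarrow> w = pi_down n w"
  proof
    assume "one_stack_sortable n w"
    then have "w \<circ> inv (pi_down n w) = id" by (simp add: one_stack_sortable_def affine_stack_sort_def)
    then show "w = pi_down n w"
      using affine_symD(2)[OF pi(1)] by (metis comp_assoc comp_id id_comp inv_o_cancel)
  next
    assume "w = pi_down n w"
    then show "one_stack_sortable n w"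
      using affine_symD(3)[OF w] by (metis one_stack_sortable_def affine_stack_sort_def surj_iff)
  qed
  \<comment> \<open>\<open>pi_down n w\<close> is a 231-avoider in the class of \<open>w\<close>, so
    it equals \<open>w\<close> as soon as \<open>w\<close> avoids 231.\<close>
  also have "\<dots> \<longleftrightarrow> avoids_231 w"
    using pi syl_cong_avoids_unique[OF n w pi(1)] by (auto simp: syl_cong_def)
  finally show ?thesis .
qed

section \<open>Height functions\<close>

text \<open>The search runs over natural distances so that \<open>LEAST\<close> applies. For
  injective \<open>w\<close>, using \<open>\<lambda>x. - w x\<close> as \<open>h\<close> finds the
  next larger value of \<open>w\<close>.\<close>

definition next_le :: "(int \<Rightarrow> int) \<Rightarrow> int \<Rightarrow> int" where
  "next_le h i = i + int (LEAST k. 0 < k \<and> h (i + int k) \<le> h i)"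

lemma next_le_eqI:
  assumes "i < m" "h m \<le> h i" "\<And>j. i < j \<Longrightarrow> j < m \<Longrightarrow> h i < h j"
  shows "next_le h i = m"
proof -
  have "(LEAST k. 0 < k \<and> h (i + int k) \<le> h i) = nat (m - i)"
  proof (rule Least_equality)
    show "0 < nat (m - i) \<and> h (i + int (nat (m - i))) \<le> h i" using assms by simp
    show "nat (m - i) \<le> k" if "0 < k \<and> h (i + int k) \<le> h i" for k
      using that assms(3)[of "i + int k"] by linarith
  qed
  then show ?thesis using assms(1) by (simp add: next_le_def)
qed

lemma next_le_spec:
  assumes n: "n \<ge> 1" and per: "h (i + int n) \<le> h i"
  shows "i < next_le h i" "h (next_le h i) \<le> h i"
    "\<And>j. i < j \<Longrightarrow> j < next_le h i \<Longrightarrow> h i < h j"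
proof -
  define k where "k = (LEAST k. 0 < k \<and> h (i + int k) \<le> h i)"
  have "0 < n \<and> h (i + int n) \<le> h i" using assms by simp
  then have "0 < k \<and> h (i + int k) \<le> h i" unfolding k_def by (rule LeastI)
  then show "i < next_le h i" "h (next_le h i) \<le> h i" by (auto simp: next_le_def k_def)
  fix j assume j: "i < j" "j < next_le h i"
  then have "nat (j - i) < k" by (simp add: next_le_def k_def)
  then have "\<not> (0 < nat (j - i) \<and> h (i + int (nat (j - i))) \<le> h i)"
    unfolding k_def by (rule not_less_Least)
  then show "h i < h j" using j by simp
qed

lemma next_le_shift:
  assumes "\<And>x. h (x + m) = h x + c"
  shows "next_le h (i + m) = next_le h i + m"
proof -
  have "h (i + m + int k) = h (i + int k) + c" for k
    using assms[of "i + int k"] by (simp add: add_ac)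
  then show ?thesis using assms[of i] by (simp add: next_le_def)
qed

text \<open>\<open>h 0 = 0\<close> selects one representative among functions that differ by a
  constant.\<close>

definition height_functions :: "nat \<Rightarrow> (int \<Rightarrow> int) set" where
  "height_functions n =
     {h. (\<forall>i. h (i + int n) = h i) \<and> (\<forall>i. h (i + 1) \<le> h i + 1) \<and> h 0 = 0}"

lemma height_functionsD:
  assumes "h \<in> height_functions n"
  shows "h (i + int n) = h i" "h (i + 1) \<le> h i + 1" "h 0 = 0"
  using assms by (auto simp: height_functions_def)

lemma height_growth:
  assumes h: "h \<in> height_functions n" and "i \<le> j"
  shows "h j \<le> h i + (j - i)"
  using \<open>i \<le> j\<close>
proof (induction j rule: int_ge_induct)
  case (step j)
  then show ?case using height_functionsD(2)[OF h, of j] by simp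
qed simp

text \<open>Each position carries one opening bracket followed by some closing brackets, and a height
  function counts the open ones. The \<open>i\<close>-th entry is the number of closing brackets at \<open>i\<close>.\<close>

definition height_to_list :: "nat \<Rightarrow> (int \<Rightarrow> int) \<Rightarrow> nat list" where
  "height_to_list n h = map (\<lambda>i. nat (h (int i) + 1 - h (int i + 1))) [0..<n]"

definition list_to_height :: "nat \<Rightarrow> nat list \<Rightarrow> int \<Rightarrow> int" where
  "list_to_height n l i = (\<Sum>j < nat (i mod int n). 1 - int (l ! j))"

text \<open>Telescoping recovers \<open>h\<close> from the list entries, and periodicity of
  \<open>h\<close> amounts to their sum being \<open>n\<close>.\<close>

lemma bij_betw_height_to_list:
  assumes n: "n \<ge> 1"
  shows "bij_betw (height_to_list n) (height_functions n) {l. length l = n \<and> sum_list l = n}"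
proof (rule bij_betw_byWitness[where f' = "list_to_height n"]; (rule ballI | rule image_subsetI))
  fix h assume h: "h \<in> height_functions n"
  \<comment> \<open>The growth bound keeps \<open>nat\<close> from truncating.\<close>
  have nth: "int (height_to_list n h ! j) = h (int j) + 1 - h (int j + 1)" if "j < n" for j
    using that height_functionsD(2)[OF h, of "int j"] by (simp add: height_to_list_def)
  have tele: "(\<Sum>j<m. h (int j + 1) - h (int j)) = h (int m)" for m
    using sum_lessThan_telescope[of "\<lambda>j. h (int j)" m] height_functionsD(3)[OF h]
    by (simp add: add.commute)
  have part: "(\<Sum>j<m. 1 - int (height_to_list n h ! j)) = h (int m)" if "m \<le> n" for m
  proof -
    have "(\<Sum>j<m. 1 - int (height_to_list n h ! j)) = (\<Sum>j<m. h (int j + 1) - h (int j))"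
      using that nth by (intro sum.cong) auto
    then show ?thesis using tele by simp
  qed
  show "list_to_height n (height_to_list n h) = h"
  proof
    fix i
    have "h i = h (i mod int n + (i div int n) * int n)" by simp
    also have "\<dots> = h (i mod int n) + (i div int n) * 0"
      by (rule shift_int_multiple) (simp add: height_functionsD[OF h])
    also have "\<dots> = h (int (nat (i mod int n)))" using n by simp
    also have "\<dots> = list_to_height n (height_to_list n h) i"
      unfolding list_to_height_def using n pos_mod_bound[of "int n" i]
      by (intro part[symmetric]) linarith
    finally show "list_to_height n (height_to_list n h) i = h i" by simp
  qed
  have len: "length (height_to_list n h) = n" by (simp add: height_to_list_def)
  have "h (int n) = 0" using height_functionsD(1)[OF h, of 0] height_functionsD(3)[OF h] by simp
  then have "(\<Sum>j<n. int (height_to_list n h ! j)) = int n"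
    using part[of n] by (simp add: sum_subtractf)
  then have "sum_list (height_to_list n h) = n"
    by (simp add: sum_list_sum_nth len atLeast0LessThan flip: of_nat_sum)
  then show "height_to_list n h \<in> {l. length l = n \<and> sum_list l = n}" using len by simp
next
  fix l :: "nat list" assume l: "l \<in> {l. length l = n \<and> sum_list l = n}"
  have "(\<Sum>j<n. l ! j) = n" using l by (auto simp: sum_list_sum_nth atLeast0LessThan)
  then have total: "(\<Sum>j<n. 1 - int (l ! j)) = 0" by (simp add: sum_subtractf flip: of_nat_sum)
  \<comment> \<open>At \<open>m = n\<close> the left side wraps around to the empty sum, and the
    right side vanishes by \<open>total\<close>.\<close>
  have at: "list_to_height n l (int m) = (\<Sum>j<m. 1 - int (l ! j))" if "m \<le> n" for m
    using that total by (cases "m = n") (auto simp: list_to_height_def)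
  have step: "list_to_height n l (int k) + 1 - list_to_height n l (int k + 1) = int (l ! k)"
    if "k < n" for k
    using at[of k] at[of "Suc k"] that by (simp add: add.commute)
  show "height_to_list n (list_to_height n l) = l"
    using l step by (intro nth_equalityI) (auto simp: height_to_list_def)
  have red: "list_to_height n l (i mod int n) = list_to_height n l i"
    "list_to_height n l (i mod int n + 1) = list_to_height n l (i + 1)" for i
    by (simp_all add: list_to_height_def mod_simps)
  have "list_to_height n l (i + 1) \<le> list_to_height n l i + 1" for i
  proof -
    have "nat (i mod int n) < n" using n by (simp add: nat_less_iff)
    from step[OF this] show ?thesis using red[of i] n by simp
  qed
  then show "list_to_height n l \<in> height_functions n"
    by (simp add: height_functions_def list_to_height_def)
qed

lemma card_height_functions:
  assumes "n \<ge> 1"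
  shows "card (height_functions n) = (2 * n - 1) choose n" "finite (height_functions n)"
proof -
  note bij = bij_betw_height_to_list[OF assms]
  have c: "card {l :: nat list. length l = n \<and> sum_list l = n} = (2 * n - 1) choose n"
    using card_length_sum_list[of n n] by (simp add: mult_2)
  then show "card (height_functions n) = (2 * n - 1) choose n" using bij_betw_same_card[OF bij] by simp
  \<comment> \<open>Infinite sets have \<open>card\<close> 0, so a positive count gives
    finiteness.\<close>
  have "(2 * n - 1) choose n > 0" using assms by (simp add: zero_less_binomial_iff)
  then show "finite (height_functions n)"
    using c bij_betw_finite[OF bij] card_ge_0_finite by metis
qed

section \<open>Enumeration of 231-avoiding affine permutations\<close>

text \<open>The subtracted constant translates the values to the window sum prescribed by
  \<open>affine_sym\<close>.\<close>

definition height_to_perm :: "nat \<Rightarrow> (int \<Rightarrow> int) \<Rightarrow> int \<Rightarrow> int" where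
  "height_to_perm n h i = next_le h i - h i -
     ((\<Sum>j = 1..int n. next_le h j - h j) - int ((n + 1) choose 2)) div int n"

text \<open>Before \<open>next_le h i\<close> the heights exceed \<open>h i\<close>, and at that
  position they no longer do. So the search from such a \<open>j\<close> ends there at the latest,
  and the value at \<open>j\<close> is smaller.\<close>

lemma height_to_perm_order:
  assumes n: "n \<ge> 1" and h: "h \<in> height_functions n" and ij: "i < j"
  shows "height_to_perm n h j < height_to_perm n h i \<longleftrightarrow> j < next_le h i"
    "height_to_perm n h i < height_to_perm n h j \<longleftrightarrow> next_le h i \<le> j"
proof -
  have spec: "x < next_le h x" "h (next_le h x) \<le> h x"
    "\<And>y. x < y \<Longrightarrow> y < next_le h x \<Longrightarrow> h x < h y" for x
    using next_le_spec[OF n, of h x] height_functionsD(1)[OF h, of x] by auto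
  have "next_le h j - h j < next_le h i - h i" if j: "j < next_le h i"
  proof -
    have hij: "h i < h j" using spec(3) ij j by blast
    have "next_le h j \<le> next_le h i"
    proof (rule ccontr)
      assume "\<not> next_le h j \<le> next_le h i"
      then have "h j < h (next_le h i)" using spec(3)[of j "next_le h i"] j by simp
      then show False using spec(2)[of i] hij by simp
    qed
    then show ?thesis using hij by simp
  qed
  \<comment> \<open>Growth by at most one per step from \<open>next_le h i\<close> to
    \<open>j\<close> gives \<open>next_le h i - h i <= j - h j\<close>, and
    \<open>j < next_le h j\<close>.\<close>
  moreover have "next_le h i - h i < next_le h j - h j" if j: "next_le h i \<le> j"
    using height_growth[OF h j] spec(2)[of i] spec(1)[of j] by simp
  ultimately show "height_to_perm n h j < height_to_perm n h i \<longleftrightarrow> j < next_le h i"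
    "height_to_perm n h i < height_to_perm n h j \<longleftrightarrow> next_le h i \<le> j"
    unfolding height_to_perm_def by (smt (verit))+
qed

lemma height_to_perm_affine_sym:
  assumes n: "n \<ge> 1" and h: "h \<in> height_functions n"
  shows "height_to_perm n h \<in> affine_sym n"
proof -
  let ?w = "height_to_perm n h" and ?u = "\<lambda>i. next_le h i - h i"
  have shift_u: "?u (i + int n) = ?u i + int n" for i
    using next_le_shift[of h "int n" 0 i] height_functionsD(1)[OF h] by simp
  then have shift: "?w (i + int n) = ?w i + int n" for i
    by (simp add: height_to_perm_def)
  have "?w i \<noteq> ?w j" if "i < j" for i j
    using height_to_perm_order[OF n h that] by linarith
  then have inj: "inj ?w" by (metis injI linorder_neqE)
  have "inj ?u"
  proof (rule injI)
    fix i j assume "?u i = ?u j"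
    then have "?w i = ?w j" by (simp only: height_to_perm_def)
    then show "i = j" using inj by (simp add: inj_eq)
  qed
  then obtain c where c: "(\<Sum>i = 1..int n. ?u i) = int ((n + 1) choose 2) + c * int n"
    using sum_period_mod[of n ?u, OF n _ shift_u] by blast
  \<comment> \<open>The \<open>div\<close> in \<open>height_to_perm\<close> is exact here and
    returns \<open>c\<close>.\<close>
  then have "?w i = ?u i - c" for i using n by (simp add: height_to_perm_def)
  then have "(\<Sum>i = 1..int n. ?w i) = int ((n + 1) choose 2)"
    using c by (simp add: sum_subtractf)
  then show ?thesis
    using shift shift_inj_imp_bij[OF n inj shift] by (simp add: affine_sym_def)
qed

text \<open>A larger value at \<open>j\<close> means \<open>next_le h i <= j\<close>, and then all
  later positions also carry larger values than \<open>i\<close>.\<close>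

lemma height_to_perm_avoids_231:
  assumes n: "n \<ge> 1" and h: "h \<in> height_functions n"
  shows "avoids_231 (height_to_perm n h)"
  unfolding avoids_231_def
proof clarify
  fix i j k
  assume "i < j" "j < k" and "height_to_perm n h k < height_to_perm n h i"
    "height_to_perm n h i < height_to_perm n h j"
  then show False
    using height_to_perm_order[OF n h, of i j] height_to_perm_order[OF n h, of i k] by simp
qed

text \<open>The relative order of the values reveals \<open>next_le\<close>; subtracting it leaves
  the negated height up to a constant, which \<open>h 0 = 0\<close> fixes.\<close>

lemma inj_on_height_to_perm:
  assumes n: "n \<ge> 1"
  shows "inj_on (height_to_perm n) (height_functions n)"
proof (rule inj_onI)
  fix g h assume g: "g \<in> height_functions n" and h: "h \<in> height_functions n"
    and eq: "height_to_perm n g = height_to_perm n h"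
  have "next_le g i = next_le h i" for i
  proof -
    have "j < next_le g i \<longleftrightarrow> j < next_le h i" if "i < j" for j
      using height_to_perm_order(1)[OF n g that] height_to_perm_order(1)[OF n h that] eq by simp
    moreover have "i < next_le g i" "i < next_le h i"
      using next_le_spec(1)[OF n] height_functionsD(1)[OF g] height_functionsD(1)[OF h] by simp_all
    ultimately show ?thesis by (meson less_irrefl linorder_neqE)
  qed
  then have "g i - g 0 = h i - h 0" for i
    using fun_cong[OF eq, of i] fun_cong[OF eq, of 0] by (simp add: height_to_perm_def)
  then show "g = h" using height_functionsD(3)[OF g] height_functionsD(3)[OF h] by auto
qed

section \<open>From 231-avoiding permutations to height functions\<close>

definition larger_left :: "(int \<Rightarrow> int) \<Rightarrow> int \<Rightarrow> int set" where
  "larger_left w i = {p. p < i \<and> w i < w p}"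

definition perm_to_height :: "(int \<Rightarrow> int) \<Rightarrow> int \<Rightarrow> int" where
  "perm_to_height w i = int (card (larger_left w i)) - int (card (larger_left w 0))"

lemma finite_larger_left:
  assumes "n \<ge> 1" "w \<in> affine_sym n"
  shows "finite (larger_left w i)"
proof -
  obtain B where B: "\<And>i. \<bar>w i - i\<bar> \<le> B" using affine_sym_bounded_displacement[OF assms] by blast
  have "larger_left w i \<subseteq> {i - 2 * B..i}"
  proof
    fix p assume "p \<in> larger_left w i"
    then show "p \<in> {i - 2 * B..i}" using B[of p] B[of i] by (auto simp: larger_left_def)
  qed
  then show ?thesis by (rule finite_subset) simp
qed

lemma card_larger_left_shift:
  assumes w: "w \<in> affine_sym n"
  shows "card (larger_left w (i + int n)) = card (larger_left w i)"
proof -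
  have "larger_left w (i + int n) = (\<lambda>p. p + int n) ` larger_left w i"
  proof (intro equalityI subsetI)
    fix p assume p: "p \<in> larger_left w (i + int n)"
    then have "p - int n \<in> larger_left w i"
      using affine_symD(4)[OF w, of i] affine_symD(4)[OF w, of "p - int n"]
      by (simp add: larger_left_def)
    then show "p \<in> (\<lambda>p. p + int n) ` larger_left w i" by force
  qed (auto simp: larger_left_def affine_symD(4)[OF w])
  then show ?thesis by (simp add: card_image)
qed

lemma perm_to_height_functions:
  assumes n: "n \<ge> 1" and w: "w \<in> affine_sym n" and av: "avoids_231 w"
  shows "perm_to_height w \<in> height_functions n"
proof -
  have step: "card (larger_left w (i + 1)) \<le> Suc (card (larger_left w i))" for i
  proof -
    have "p \<in> insert i (larger_left w i)" if "p \<in> larger_left w (i + 1)" for p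
    proof (cases "p = i")
      case False
      then have p: "p < i" "w (i + 1) < w p" using that by (auto simp: larger_left_def)
      \<comment> \<open>Otherwise \<open>p\<close>, \<open>i\<close>, \<open>i + 1\<close> would
        form a 231 pattern.\<close>
      then have "\<not> w p < w i" using av by (auto simp: avoids_231_def)
      moreover have "w p \<noteq> w i" using p affine_symD(2)[OF w] by (auto dest: injD)
      ultimately show ?thesis using p by (simp add: larger_left_def)
    qed simp
    then have "card (larger_left w (i + 1)) \<le> card (insert i (larger_left w i))"
      using finite_larger_left[OF n w] by (intro card_mono) auto
    also have "\<dots> \<le> Suc (card (larger_left w i))" by (rule card_insert_le_m1) auto
    finally show ?thesis .
  qed
  have "perm_to_height w (i + 1) \<le> perm_to_height w i + 1" for i
    using step[of i] by (simp add: perm_to_height_def)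
  then show ?thesis
    by (simp add: height_functions_def perm_to_height_def card_larger_left_shift[OF w])
qed

lemma next_greater_spec:
  assumes n: "n \<ge> 1" and w: "w \<in> affine_sym n"
  shows "i < next_le (\<lambda>x. - w x) i" "w i < w (next_le (\<lambda>x. - w x) i)"
    "\<And>j. i < j \<Longrightarrow> j < next_le (\<lambda>x. - w x) i \<Longrightarrow> w j < w i"
proof -
  have "- w (i + int n) \<le> - w i" using affine_symD(4)[OF w, of i] by simp
  note spec = next_le_spec[where h = "\<lambda>x. - w x", OF n this]
  show "i < next_le (\<lambda>x. - w x) i" using spec(1) .
  then have "w i \<noteq> w (next_le (\<lambda>x. - w x) i)"
    using inj_eq[OF affine_symD(2)[OF w]] by (metis less_irrefl)
  then show "w i < w (next_le (\<lambda>x. - w x) i)" using spec(2) by simp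
  show "\<And>j. i < j \<Longrightarrow> j < next_le (\<lambda>x. - w x) i \<Longrightarrow> w j < w i" using spec(3) by simp
qed

text \<open>Before the next larger value, each position sees everything that \<open>i\<close> sees
  and also \<open>i\<close> itself, so its height exceeds that of \<open>i\<close>. At the next
  larger value, all positions from \<open>i\<close> on are smaller and drop out of the
  count.\<close>

lemma next_le_perm_to_height:
  assumes n: "n \<ge> 1" and w: "w \<in> affine_sym n"
  shows "next_le (perm_to_height w) i = next_le (\<lambda>x. - w x) i"
proof (rule next_le_eqI)
  let ?m = "next_le (\<lambda>x. - w x) i"
  note spec = next_greater_spec[OF n w, of i]
  show "i < ?m" by (rule spec(1))
  have "larger_left w ?m \<subseteq> larger_left w i"
  proof
    fix p assume p: "p \<in> larger_left w ?m"
    then have "w i < w p" "p < ?m" using spec(2) by (auto simp: larger_left_def)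
    moreover from this have "p < i" using spec(3)[of p] by (cases p i rule: linorder_cases) auto
    ultimately show "p \<in> larger_left w i" by (simp add: larger_left_def)
  qed
  then show "perm_to_height w ?m \<le> perm_to_height w i"
    using card_mono[OF finite_larger_left[OF n w]] by (simp add: perm_to_height_def)
  fix j assume j: "i < j" "j < ?m"
  then have "insert i (larger_left w i) \<subseteq> larger_left w j"
    using spec(3)[of j] by (auto simp: larger_left_def)
  then have "card (insert i (larger_left w i)) \<le> card (larger_left w j)"
    by (rule card_mono[OF finite_larger_left[OF n w]])
  moreover have "i \<notin> larger_left w i" by (simp add: larger_left_def)
  ultimately show "perm_to_height w i < perm_to_height w j"
    using finite_larger_left[OF n w] by (simp add: perm_to_height_def)
qed

text \<open>Past the next larger value, a value below \<open>w i\<close> would complete a 231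
  pattern.\<close>

lemma avoids_231_less_iff:
  assumes n: "n \<ge> 1" and w: "w \<in> affine_sym n" and av: "avoids_231 w" and ij: "i < j"
  shows "w i < w j \<longleftrightarrow> next_le (\<lambda>x. - w x) i \<le> j"
proof -
  let ?m = "next_le (\<lambda>x. - w x) i"
  note spec = next_greater_spec[OF n w, of i]
  have "w i < w j" if "?m \<le> j"
  proof (cases "j = ?m")
    case False
    then have "\<not> w j < w i" using that spec av unfolding avoids_231_def by (metis order_le_less)
    moreover have "w i \<noteq> w j" using ij affine_symD(2)[OF w] by (auto dest: injD)
    ultimately show ?thesis by simp
  qed (use spec in simp)
  then show ?thesis using spec(3)[OF ij] by linarith
qed

text \<open>Heights determine the next larger positions, these the relative order, and this the
  affine permutation.\<close>

lemma inj_on_perm_to_height: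
  assumes n: "n \<ge> 1"
  shows "inj_on perm_to_height {w \<in> affine_sym n. avoids_231 w}"
proof (rule inj_onI, clarify)
  fix v w assume v: "v \<in> affine_sym n" "avoids_231 v" and w: "w \<in> affine_sym n" "avoids_231 w"
    and eq: "perm_to_height v = perm_to_height w"
  have "next_le (\<lambda>x. - v x) i = next_le (\<lambda>x. - w x) i" for i
    using next_le_perm_to_height[OF n v(1)] next_le_perm_to_height[OF n w(1)] eq by metis
  then show "v = w"
    using affine_sym_eqI[OF n v(1) w(1)] avoids_231_less_iff[OF n v] avoids_231_less_iff[OF n w]
    by simp
qed

lemma card_avoids_231:
  assumes n: "n \<ge> 1"
  shows "card {w \<in> affine_sym n. avoids_231 w} = (2 * n - 1) choose n"
proof -
  let ?A = "{w \<in> affine_sym n. avoids_231 w}"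
  have sub: "perm_to_height ` ?A \<subseteq> height_functions n" using perm_to_height_functions[OF n] by auto
  have fin: "finite ?A"
    using inj_on_finite[OF inj_on_perm_to_height[OF n] sub] card_height_functions(2)[OF n] .
  \<comment> \<open>Both sets are finite, so injections in both directions give equal
    cardinalities.\<close>
  have "card ?A = card (height_functions n)"
  proof (rule card_bij_eq)
    show "height_to_perm n ` height_functions n \<subseteq> ?A"
      using height_to_perm_affine_sym[OF n] height_to_perm_avoids_231[OF n] by auto
  qed (use sub fin inj_on_perm_to_height[OF n] inj_on_height_to_perm[OF n]
      card_height_functions(2)[OF n] in auto)
  then show ?thesis using card_height_functions(1)[OF n] by simp
qed

theorem proposition8p2:
  fixes n :: nat
  assumes "n \<ge> 1"
  shows "(\<forall>w \<in> affine_sym n. one_stack_sortable n w \<longleftrightarrow> avoids_231 w) \<and>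
         card {w \<in> affine_sym n. one_stack_sortable n w} = (2 * n - 1) choose n"
proof
  show sortable: "\<forall>w \<in> affine_sym n. one_stack_sortable n w \<longleftrightarrow> avoids_231 w"
    using one_stack_sortable_iff_avoids_231[OF assms] by blast
  then have "{w \<in> affine_sym n. one_stack_sortable n w} = {w \<in> affine_sym n. avoids_231 w}"
    by blast
  then show "card {w \<in> affine_sym n. one_stack_sortable n w} = (2 * n - 1) choose n"
    using card_avoids_231[OF assms] by simp
qed

end
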